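(* For $0<\rho<1$ let $\Omega_\rho=\{x\in\mathbb R^4:\rho<|x|<1\}$, and for an integer $k\ge2$ and $r\in(\rho,1)$ let $$\Lambda_1(r)=\tau_\rho(\xi_1(r))-\sum_{j=1}^{k-1}G_\rho(\xi_1(r),\xi_{j+1}(r)),$$ where $\xi_j(r)=\big(r\cos\tfrac{2\pi(j-1)}{k},\,r\sin\tfrac{2\pi(j-1)}{k},\,0,\,0\big)$, $j=1,\dots,k$. (i) If $k=2$, then for every $\rho\in(\tfrac1{15},1)$ one has $\min_{r\in(\rho,1)}\Lambda_1(r)>0$. (ii) If $k=4$, then for every $\rho\in(\tfrac5{11},1)$ one has $\min_{r\in(\rho,1)}\Lambda_1(r)>0$.
   Context: $G_\rho(x,y)=\frac{1}{2\omega}\frac{1}{|x-y|^2}-H_\rho(x,y)$, with $\omega=2\pi^2$, is the Green function of $-\Delta$ in the annulus $\Omega_\rho$ with Dirichlet boundary condition; $H_\rho(\cdot,y)$ is harmonic in $\Omega_\rho$ with boundary values $\frac{1}{2\omega|x-y|^2}$ for $x\in\partial\Omega_\rho$, and $\tau_\rho(x)=H_\rho(x,x)$ is the Robin function. The number $\Lambda_1(r)$ is the smallest eigenvalue of the symmetric $k\times k$ matrix with diagonal entries $\tau_\rho(\xi_i(r))$ and off-diagonal entries $-G_\rho(\xi_i(r),\xi_j(r))$. One has $\Lambda_1(r)\to+\infty$ as $r\to\rho^+$ and as $r\to1^-$, so the minimum over $(\rho,1)$ is attained. *)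

theory Defs
  imports "HOL-Analysis.Analysis"
begin

text \<open>
  \<open>g\<close> is the gradient of \<open>f\<close>, \<open>D x\<close> the derivative of the gradient at \<open>x\<close> (the Hessian of
  \<open>f\<close> as a linear map), and the trace of \<open>D x\<close> is the Laplacian.  On an open set \<open>g\<close> and \<open>D\<close> are determined
  by \<open>f\<close>; continuity of the Hessian is stated on basis vectors.  The notion is meant for open \<open>S\<close>.
\<close>

definition harmonic_on :: "'a::euclidean_space set \<Rightarrow> ('a \<Rightarrow> real) \<Rightarrow> bool" where
  "harmonic_on S f \<longleftrightarrow>
     (\<exists>g :: 'a \<Rightarrow> 'a. \<exists>D :: 'a \<Rightarrow> 'a \<Rightarrow> 'a.
        (\<forall>x\<in>S. GDERIV f x :> g x) \<and>
        (\<forall>x\<in>S. (g has_derivative D x) (at x)) \<and>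
        (\<forall>b\<in>Basis. continuous_on S (\<lambda>x. D x b)) \<and>
        (\<forall>x\<in>S. (\<Sum>b\<in>Basis. D x b \<bullet> b) = 0))"

definition annulus :: "real \<Rightarrow> (real^4) set" where
  "annulus \<rho> = {x. \<rho> < norm x \<and> norm x < 1}"

text \<open>The area of the unit sphere of \<open>\<real>\<^sup>4\<close>.\<close>

definition omega :: real where
  "omega = 2 * pi\<^sup>2"

definition fund_sol :: "real^4 \<Rightarrow> real^4 \<Rightarrow> real" where
  "fund_sol x y = 1 / (2 * omega) * (1 / (norm (x - y))\<^sup>2)"

text \<open>
  The boundary values are attained in the classical sense, by continuity up to the boundary.
  By the maximum principle this determines \<open>H x y\<close> for \<open>x \<in> closure (annulus \<rho>)\<close> and
  \<open>y \<in> annulus \<rho>\<close>; other values of \<open>H\<close> are unconstrained.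
\<close>

definition green_regular_part :: "real \<Rightarrow> (real^4 \<Rightarrow> real^4 \<Rightarrow> real) \<Rightarrow> bool" where
  "green_regular_part \<rho> H \<longleftrightarrow>
     (\<forall>y\<in>annulus \<rho>.
        continuous_on (closure (annulus \<rho>)) (\<lambda>x. H x y) \<and>
        harmonic_on (annulus \<rho>) (\<lambda>x. H x y) \<and>
        (\<forall>x\<in>frontier (annulus \<rho>). H x y = fund_sol x y))"

text \<open>In \<open>green\<close>, \<open>robin\<close> and \<open>Lambda1\<close> the argument \<open>H\<close> stands for the regular part.\<close>

definition green :: "(real^4 \<Rightarrow> real^4 \<Rightarrow> real) \<Rightarrow> real^4 \<Rightarrow> real^4 \<Rightarrow> real" where
  "green H x y = fund_sol x y - H x y"

definition robin :: "(real^4 \<Rightarrow> real^4 \<Rightarrow> real) \<Rightarrow> real^4 \<Rightarrow> real" where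
  "robin H x = H x x"

definition xi :: "nat \<Rightarrow> nat \<Rightarrow> real \<Rightarrow> real^4" where
  "xi k j r = (\<chi> i. if i = 1 then r * cos (2 * pi * (real j - 1) / real k)
                    else if i = 2 then r * sin (2 * pi * (real j - 1) / real k)
                    else 0)"

definition Lambda1 :: "(real^4 \<Rightarrow> real^4 \<Rightarrow> real) \<Rightarrow> nat \<Rightarrow> real \<Rightarrow> real" where
  "Lambda1 H k r = robin H (xi k 1 r) - (\<Sum>j=1..k-1. green H (xi k 1 r) (xi k (j + 1) r))"

definition has_positive_min_on :: "real set \<Rightarrow> (real \<Rightarrow> real) \<Rightarrow> bool" where
  "has_positive_min_on S f \<longleftrightarrow> (\<exists>r0\<in>S. (\<forall>r\<in>S. f r0 \<le> f r) \<and> f r0 > 0)"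

end

theory Submission
  imports Defs
begin

text \<open>
  The Green function of a spherical annulus can be built by repeated reflection of the charge in
  the two boundary spheres.  A charge at \<open>y\<close> has its images at \<open>c y\<close> for \<open>c = \<rho>\<^sup>2\<^sup>l\<close> (sign \<open>+\<close>)
  and \<open>c = \<rho>\<^sup>2\<^sup>l/|y|\<^sup>2\<close> (sign \<open>-\<close>), with \<open>l\<close> ranging over the integers, and in dimension four the
  image at \<open>c y\<close> has potential \<open>c/|x - c y|\<^sup>2\<close>.  The images other than the charge itself, with
  opposite signs, make up \<open>2 \<omega> H\<close>.  A suitable finite sum of them is harmonic and misses the
  prescribed boundary values by the potential of a single image, so the maximum principle shows
  that the finite sums converge to \<open>2 \<omega> H\<close> geometrically and uniformly
  (\<open>image_sum_approximates_regular_part\<close>).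

  At the vertices of a regular \<open>k\<close>-gon of radius \<open>r\<close> the image potentials depend only on \<open>c\<close> and
  on the angles.  With \<open>\<phi>(t) = \<Sum>\<^sub>j t/(1 - 2 t cos(2\<pi>j/k) + t\<^sup>2)\<close>, \<open>0 \<le> j < k\<close> (\<open>orbit_kernel\<close>), one
  obtains
  \<open>2 \<omega> r\<^sup>2 \<Lambda>\<^sub>1(r) = \<Sum>\<^sub>l (\<phi>(r\<^sup>2 \<rho>\<^sup>2\<^sup>l) + \<phi>(\<rho>\<^sup>2\<^sup>l\<^sup>+\<^sup>2/r\<^sup>2) - 2 \<phi>(\<rho>\<^sup>2\<^sup>l\<^sup>+\<^sup>2)) - C\<^sub>k\<close>, \<open>l \<ge> 0\<close>,
  where \<open>C\<^sub>k\<close>, the sum of \<open>1/(2 - 2 cos(2\<pi>j/k))\<close> over \<open>0 < j < k\<close>, comes from the fundamental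
  solution.  If \<open>\<phi>\<close> increases on \<open>(0,1)\<close>, every summand is nonnegative, so \<open>2 \<omega> r\<^sup>2 \<Lambda>\<^sub>1(r)\<close> is at
  least the first one minus \<open>C\<^sub>k\<close> (\<open>Lambda1_ge_first_layer\<close>).  The first summand also blows up at both ends of
  \<open>(\<rho>,1)\<close>, so that a positive minimum exists as soon as it exceeds \<open>C\<^sub>k\<close>
  (\<open>Lambda1_has_positive_min\<close>).

  For \<open>k = 2\<close> and \<open>k = 4\<close> the function \<open>\<phi>\<close> is an explicit increasing rational function, with
  \<open>C\<^sub>2 = 1/4\<close> and \<open>C\<^sub>4 = 5/4\<close>.  The first summand is at least \<open>\<phi>(\<rho>) - \<phi>(\<rho>\<^sup>2)\<close>, which suffices for
  \<open>k = 4\<close>, and for \<open>k = 2\<close> if \<open>\<rho> \<ge> 3/20\<close>.  The remaining range \<open>1/15 < \<rho> < 3/20\<close> needs a sharper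
  estimate (\<open>first_layer_2_gt\<close>).
\<close>

section \<open>Harmonic functions and the maximum principle\<close>

lemma annulus_open: "open (annulus \<rho>)"
  unfolding annulus_def by (intro open_Collect_conj open_Collect_less continuous_intros)

lemma annulus_bounded: "bounded (annulus \<rho>)"
  by (rule boundedI[where B = 1]) (auto simp: annulus_def)

lemma closure_annulus_norm: "x \<in> closure (annulus \<rho>) \<Longrightarrow> \<rho> \<le> norm x \<and> norm x \<le> 1"
proof -
  have "closed {x :: real^4. \<rho> \<le> norm x \<and> norm x \<le> 1}"
    by (intro closed_Collect_conj closed_Collect_le continuous_intros)
  then have "closure (annulus \<rho>) \<subseteq> {x :: real^4. \<rho> \<le> norm x \<and> norm x \<le> 1}"
    by (intro closure_minimal) (auto simp: annulus_def)
  then show "x \<in> closure (annulus \<rho>) \<Longrightarrow> \<rho> \<le> norm x \<and> norm x \<le> 1" by auto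
qed

lemma frontier_annulus_norm:
  assumes "x \<in> frontier (annulus \<rho>)"
  shows "norm x = \<rho> \<or> norm x = 1"
proof -
  have "x \<in> closure (annulus \<rho>)" "x \<notin> annulus \<rho>"
    using assms by (simp_all add: frontier_def interior_open[OF annulus_open])
  with closure_annulus_norm[of x \<rho>] show ?thesis by (force simp: annulus_def)
qed

text \<open>
  Only the second derivative at the maximum itself is known, so the usual test is run through
  monotonicity: \<open>f'\<close> vanishes at \<open>0\<close> and is positive just to the right of it.
\<close>

lemma no_local_max_if_second_derivative_pos:
  fixes f f' :: "real \<Rightarrow> real"
  assumes d: "0 < d" and f': "\<And>t. \<bar>t\<bar> < d \<Longrightarrow> (f has_field_derivative f' t) (at t)"
    and f'': "(f' has_field_derivative l) (at 0)" and l: "0 < l"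
    and max: "\<And>t. \<bar>t\<bar> < d \<Longrightarrow> f t \<le> f 0"
  shows False
proof -
  have f'0: "f' 0 = 0"
    by (rule DERIV_local_max[OF f'[of 0] d]) (use d max in \<open>simp_all\<close>)
  obtain e where e: "e > 0" "\<And>h. 0 < h \<Longrightarrow> h < e \<Longrightarrow> f' 0 < f' h"
    using DERIV_pos_inc_right[OF f'' l] by (metis add_0)
  define t where "t = min e d / 2"
  have t: "0 < t" "t < e" "t < d" using e d by (auto simp: t_def)
  have "\<exists>z>0. z < t \<and> f t - f 0 = (t - 0) * f' z"
    using t f' by (intro MVT2) simp_all
  then obtain z where z: "0 < z" "z < t" "f t - f 0 = t * f' z" by auto
  have "f' z > 0" using e(2)[of z] z t f'0 by auto
  then have "t * f' z > 0" using t by simp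
  then have "f t > f 0" using z(3) by linarith
  with max[of t] t show False by auto
qed

text \<open>
  Adding \<open>\<epsilon> |x|\<^sup>2\<close> makes the Laplacian strictly positive, so at every point of \<open>S\<close> some
  pure second derivative is positive, and no point of \<open>S\<close> can be a maximum.
\<close>

lemma harmonic_le_on_frontier_imp_le:
  fixes w :: "'a::euclidean_space \<Rightarrow> real"
  assumes S: "open S" "bounded S" and cont: "continuous_on (closure S) w" and harm: "harmonic_on S w"
    and le: "\<And>x. x \<in> frontier S \<Longrightarrow> w x \<le> B" and x: "x \<in> S"
  shows "w x \<le> B"
proof (rule ccontr)
  assume "\<not> w x \<le> B"
  then have gap: "w x - B > 0" by simp
  obtain R where R: "R > 0" "\<And>x. x \<in> closure S \<Longrightarrow> norm x \<le> R"
    using bounded_closure[OF S(2)] by (auto simp: bounded_pos)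
  \<comment> \<open>Small enough that on \<open>closure S\<close> the perturbation is at most half of the gap.\<close>
  define \<epsilon> where "\<epsilon> = (w x - B) / (2 * R\<^sup>2)"
  have \<epsilon>: "\<epsilon> > 0" using gap R by (simp add: \<epsilon>_def)
  define v where "v = (\<lambda>x. w x + \<epsilon> * (x \<bullet> x))"
  have "compact (closure S)" using S by (simp add: compact_eq_bounded_closed bounded_closure)
  moreover have "closure S \<noteq> {}" using x closure_subset by auto
  moreover have "continuous_on (closure S) v"
    unfolding v_def by (intro continuous_intros cont)
  ultimately obtain z where z: "z \<in> closure S" "\<And>y. y \<in> closure S \<Longrightarrow> v y \<le> v z"
    using continuous_attains_sup[of "closure S" v] by auto
  have "z \<in> S"
  proof (rule ccontr)
    assume "z \<notin> S"
    then have "z \<in> frontier S" using z S by (simp add: frontier_def interior_open)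
    then have "v z \<le> B + \<epsilon> * R\<^sup>2"
      using le[of z] R(2)[OF z(1)] \<epsilon> unfolding v_def
      by (intro add_mono mult_left_mono) (auto simp: dot_square_norm power_mono)
    also have "\<dots> < w x" using gap R by (simp add: \<epsilon>_def field_simps)
    also have "\<dots> \<le> v x" using \<epsilon> by (simp add: v_def)
    also have "\<dots> \<le> v z" using z(2) x closure_subset by blast
    finally show False by simp
  qed
  obtain g D where g: "\<And>x. x \<in> S \<Longrightarrow> GDERIV w x :> g x"
    and D: "\<And>x. x \<in> S \<Longrightarrow> (g has_derivative D x) (at x)"
    and lap: "\<And>x. x \<in> S \<Longrightarrow> (\<Sum>b\<in>Basis. D x b \<bullet> b) = 0"
    using harm unfolding harmonic_on_def by metis
  have "(\<Sum>b\<in>Basis. D z b \<bullet> b + 2 * \<epsilon>) > 0"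
    using lap[OF \<open>z \<in> S\<close>] \<epsilon> by (simp add: sum.distrib)
  then obtain b :: 'a where b: "b \<in> Basis" "D z b \<bullet> b + 2 * \<epsilon> > 0"
    by (metis (no_types, lifting) not_less sum_nonpos)
  obtain d where d: "d > 0" "ball z d \<subseteq> S" using S \<open>z \<in> S\<close> open_contains_ball by blast
  have inS: "z + t *\<^sub>R b \<in> S" if "\<bar>t\<bar> < d" for t
    using d that b by (intro subsetD[OF d(2)]) (simp add: dist_norm)
  define f where "f = (\<lambda>t. v (z + t *\<^sub>R b))"
  define f' where "f' = (\<lambda>t. (g (z + t *\<^sub>R b) + (2 * \<epsilon>) *\<^sub>R (z + t *\<^sub>R b)) \<bullet> b)"
  have wd: "(w has_derivative (\<lambda>h. g y \<bullet> h)) (at y)" if "y \<in> S" for y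
    using g[OF that] by (simp add: gderiv_def inner_commute)
  show False
  proof (rule no_local_max_if_second_derivative_pos[OF d(1), of f f' "D z b \<bullet> b + 2 * \<epsilon>"])
    fix t :: real assume t: "\<bar>t\<bar> < d"
    have "((\<lambda>t. w (z + t *\<^sub>R b)) has_derivative (\<lambda>h. g (z + t *\<^sub>R b) \<bullet> (h *\<^sub>R b))) (at t)"
      by (rule has_derivative_compose[where f = "\<lambda>t. z + t *\<^sub>R b" and g = w, OF _ wd[OF inS[OF t]]])
         (auto intro!: derivative_eq_intros)
    then show "(f has_field_derivative f' t) (at t)"
      unfolding f_def v_def f'_def has_field_derivative_def
      by (auto intro!: derivative_eq_intros simp: algebra_simps fun_eq_iff inner_commute)
    show "f t \<le> f 0"
      using z(2)[of "z + t *\<^sub>R b"] inS[OF t] closure_subset[of S] unfolding f_def by auto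
  next
    have lin: "linear (D z)" using D[OF \<open>z \<in> S\<close>] has_derivative_linear by blast
    have "((\<lambda>t. g (z + t *\<^sub>R b)) has_derivative (\<lambda>h. D z (h *\<^sub>R b))) (at 0)"
      by (rule has_derivative_compose[of "\<lambda>t. z + t *\<^sub>R b"])
         (use D[OF \<open>z \<in> S\<close>] in \<open>auto intro!: derivative_eq_intros\<close>)
    then show "(f' has_field_derivative D z b \<bullet> b + 2 * \<epsilon>) (at 0)"
      unfolding f'_def has_field_derivative_def using b(1)
      by (auto intro!: derivative_eq_intros
          simp: algebra_simps fun_eq_iff linear_cmul[OF lin] inner_commute)
  qed (use b in auto)
qed

lemma harmonic_on_add:
  assumes "harmonic_on S f" "harmonic_on S g"
  shows "harmonic_on S (\<lambda>x. f x + g x)"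
proof -
  obtain f1 f2 where f: "\<forall>x\<in>S. GDERIV f x :> f1 x" "\<forall>x\<in>S. (f1 has_derivative f2 x) (at x)"
    "\<forall>b\<in>Basis. continuous_on S (\<lambda>x. f2 x b)" "\<forall>x\<in>S. (\<Sum>b\<in>Basis. f2 x b \<bullet> b) = 0"
    using assms(1) unfolding harmonic_on_def by blast
  obtain g1 g2 where g: "\<forall>x\<in>S. GDERIV g x :> g1 x" "\<forall>x\<in>S. (g1 has_derivative g2 x) (at x)"
    "\<forall>b\<in>Basis. continuous_on S (\<lambda>x. g2 x b)" "\<forall>x\<in>S. (\<Sum>b\<in>Basis. g2 x b \<bullet> b) = 0"
    using assms(2) unfolding harmonic_on_def by blast
  show ?thesis unfolding harmonic_on_def
  proof (intro exI[of _ "\<lambda>x. f1 x + g1 x"] exI[of _ "\<lambda>x h. f2 x h + g2 x h"] conjI ballI)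
    fix x assume x: "x \<in> S"
    show "GDERIV (\<lambda>x. f x + g x) x :> f1 x + g1 x"
      using f(1) g(1) x by (blast intro: GDERIV_add)
    show "((\<lambda>x. f1 x + g1 x) has_derivative (\<lambda>h. f2 x h + g2 x h)) (at x)"
      using f(2) g(2) x by (blast intro: has_derivative_add)
    show "(\<Sum>b\<in>Basis. (f2 x b + g2 x b) \<bullet> b) = 0"
      using f(4) g(4) x by (simp add: inner_add_left sum.distrib)
  next
    fix b :: 'a assume "b \<in> Basis"
    then show "continuous_on S (\<lambda>x. f2 x b + g2 x b)"
      using f(3) g(3) by (intro continuous_on_add) auto
  qed
qed

lemma harmonic_on_cmult:
  assumes "harmonic_on S f"
  shows "harmonic_on S (\<lambda>x. c * f x)"
proof -
  obtain f1 f2 where f: "\<forall>x\<in>S. GDERIV f x :> f1 x" "\<forall>x\<in>S. (f1 has_derivative f2 x) (at x)"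
    "\<forall>b\<in>Basis. continuous_on S (\<lambda>x. f2 x b)" "\<forall>x\<in>S. (\<Sum>b\<in>Basis. f2 x b \<bullet> b) = 0"
    using assms(1) unfolding harmonic_on_def by blast
  show ?thesis unfolding harmonic_on_def
  proof (intro exI[of _ "\<lambda>x. c *\<^sub>R f1 x"] exI[of _ "\<lambda>x h. c *\<^sub>R f2 x h"] conjI ballI)
    fix x assume x: "x \<in> S"
    show "GDERIV (\<lambda>x. c * f x) x :> c *\<^sub>R f1 x"
    proof -
      have "(f has_derivative (\<lambda>h. h \<bullet> f1 x)) (at x)" using f(1) x by (simp add: gderiv_def)
      from has_derivative_mult_right[OF this, of c] show ?thesis by (simp add: gderiv_def)
    qed
    show "((\<lambda>x. c *\<^sub>R f1 x) has_derivative (\<lambda>h. c *\<^sub>R f2 x h)) (at x)"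
      using f(2) x by (blast intro: has_derivative_scaleR_right)
    show "(\<Sum>b\<in>Basis. c *\<^sub>R f2 x b \<bullet> b) = 0"
      using f(4) x by (simp flip: sum_distrib_left)
  next
    fix b :: 'a assume "b \<in> Basis"
    then show "continuous_on S (\<lambda>x. c *\<^sub>R f2 x b)" 
      using f(3) by (intro continuous_on_scaleR continuous_on_const) auto
  qed
qed

lemma harmonic_on_diff:
  assumes "harmonic_on S f" "harmonic_on S g"
  shows "harmonic_on S (\<lambda>x. f x - g x)"
  using harmonic_on_add[OF assms(1) harmonic_on_cmult[OF assms(2), of "-1"]] by simp

lemma harmonic_on_zero: "harmonic_on S (\<lambda>x. 0)"
  unfolding harmonic_on_def
  by (rule exI[of _ "\<lambda>x. 0"], rule exI[of _ "\<lambda>x h. 0"]) (auto simp: gderiv_def)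

lemma harmonic_on_sum:
  "(\<And>i. i \<in> I \<Longrightarrow> harmonic_on S (f i)) \<Longrightarrow> harmonic_on S (\<lambda>x. \<Sum>i\<in>I. f i x)"
  by (induction I rule: infinite_finite_induct) (auto intro: harmonic_on_zero harmonic_on_add)

text \<open>
  With \<open>q = |x - p|\<^sup>2\<close> the Hessian of \<open>1/q\<close> is \<open>8 q\<^sup>-\<^sup>3 (x - p)(x - p)\<^sup>T - 2 q\<^sup>-\<^sup>2 I\<close>, whose trace
  \<open>8 q\<^sup>-\<^sup>2 - 2 n q\<^sup>-\<^sup>2\<close> vanishes exactly in dimension \<open>n = 4\<close>.
\<close>

lemma harmonic_on_fundamental:
  fixes p :: "real^4"
  assumes "p \<notin> S"
  shows "harmonic_on S (\<lambda>x. 1 / (norm (x - p))\<^sup>2)"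
proof -
  define q where "q = (\<lambda>x. (x - p) \<bullet> (x - p))"
  have q: "q x > 0" if "x \<in> S" for x using that assms unfolding q_def by auto
  have dq: "(q has_derivative (\<lambda>h. 2 * ((x - p) \<bullet> h))) (at x)" for x
    unfolding q_def by (auto intro!: derivative_eq_intros simp: inner_commute)
  have qc: "continuous_on S q" unfolding q_def by (intro continuous_intros)
  have "harmonic_on S (\<lambda>x. inverse (q x))"
    unfolding harmonic_on_def
  proof (intro exI[of _ "\<lambda>x. (- 2 * inverse ((q x)^2)) *\<^sub>R (x - p)"]
      exI[of _ "\<lambda>x h. (8 * ((x - p) \<bullet> h) * inverse ((q x)^3)) *\<^sub>R (x - p) - (2 * inverse ((q x)^2)) *\<^sub>R h"]
      conjI ballI)
    fix x assume x: "x \<in> S"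
    note q0 = q[OF x]
    have idp: "((\<lambda>x. x - p) has_derivative (\<lambda>h. h)) (at x)"
      by (auto intro!: derivative_eq_intros)
    have inv: "((\<lambda>x. inverse (q x)) has_derivative
        (\<lambda>h. - (inverse (q x) * (2 * ((x - p) \<bullet> h)) * inverse (q x)))) (at x)"
      using q0 by (intro Deriv.has_derivative_inverse dq) auto
    show "GDERIV (\<lambda>x. inverse (q x)) x :> (- 2 * inverse ((q x)^2)) *\<^sub>R (x - p)"
      unfolding gderiv_def
      by (rule has_derivative_eq_rhs[OF inv]) (simp add: fun_eq_iff power2_eq_square inner_commute)
    have inv2: "((\<lambda>x. - 2 * inverse ((q x)^2)) has_derivative
        (\<lambda>h. 8 * ((x - p) \<bullet> h) * inverse ((q x)^3))) (at x)"
      unfolding power_inverse[symmetric]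
      by (rule has_derivative_eq_rhs[OF has_derivative_mult_right[OF has_derivative_power[OF inv]]])
         (simp add: fun_eq_iff power2_eq_square power3_eq_cube)
    show "((\<lambda>x. (- 2 * inverse ((q x)^2)) *\<^sub>R (x - p)) has_derivative
       (\<lambda>h. (8 * ((x - p) \<bullet> h) * inverse ((q x)^3)) *\<^sub>R (x - p) - (2 * inverse ((q x)^2)) *\<^sub>R h)) (at x)"
      by (rule has_derivative_eq_rhs[OF has_derivative_scaleR[OF inv2 idp]]) (simp add: fun_eq_iff)
    have "(\<Sum>b\<in>Basis. ((x - p) \<bullet> b) * ((x - p) \<bullet> b)) = q x"
      unfolding q_def by (rule euclidean_inner[symmetric])
    then have "(\<Sum>b\<in>Basis. 8 * inverse ((q x)^3) * (((x - p) \<bullet> b) * ((x - p) \<bullet> b))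
        - 2 * inverse ((q x)^2)) = 8 * inverse ((q x)^3) * q x - 8 * inverse ((q x)^2)"
      by (simp add: sum_subtractf flip: sum_distrib_left)
    moreover have "((8 * ((x - p) \<bullet> b) * inverse ((q x)^3)) *\<^sub>R (x - p) - (2 * inverse ((q x)^2)) *\<^sub>R b) \<bullet> b
        = 8 * inverse ((q x)^3) * (((x - p) \<bullet> b) * ((x - p) \<bullet> b)) - 2 * inverse ((q x)^2)"
      if "b \<in> Basis" for b using that by (simp add: inner_diff_left)
    ultimately have "(\<Sum>b\<in>Basis. ((8 * ((x - p) \<bullet> b) * inverse ((q x)^3)) *\<^sub>R (x - p) - (2 * inverse ((q x)^2)) *\<^sub>R b) \<bullet> b)
        = 8 * inverse ((q x)^3) * q x - 8 * inverse ((q x)^2)"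
      by simp
    also have "\<dots> = 0" using q0 by (simp add: power2_eq_square power3_eq_cube field_simps)
    finally show "(\<Sum>b\<in>Basis. ((8 * ((x - p) \<bullet> b) * inverse ((q x)^3)) *\<^sub>R (x - p) - (2 * inverse ((q x)^2)) *\<^sub>R b) \<bullet> b) = 0" .
  next
    fix b :: "real^4"
    show "continuous_on S (\<lambda>x. (8 * ((x - p) \<bullet> b) * inverse ((q x)^3)) *\<^sub>R (x - p) - (2 * inverse ((q x)^2)) *\<^sub>R b)"
      
      by (intro continuous_on_diff continuous_on_scaleR continuous_on_mult continuous_on_inverse
          continuous_on_power continuous_on_inner continuous_on_const continuous_on_id qc ballI)
         (force dest: q)+
  qed
  then show ?thesis by (simp add: q_def power2_norm_eq_inner inverse_eq_divide)
qed

section \<open>Image charges in the annulus\<close>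

text \<open>
  The numerator \<open>c\<close> is the charge that the image at \<open>c y\<close> carries: with this normalization
  inversion acts on the parameter \<open>c\<close> alone (\<open>image_kernel_reflect\<close>), with no extra weight.
\<close>

definition image_kernel :: "real^4 \<Rightarrow> real \<Rightarrow> real^4 \<Rightarrow> real" where
  "image_kernel y c x = c / (norm (x - c *\<^sub>R y))\<^sup>2"

lemma norm_diff_scaleR_sq:
  fixes x y :: "'a::real_inner"
  shows "(norm (x - c *\<^sub>R y))\<^sup>2 = (norm x)\<^sup>2 - 2 * c * (x \<bullet> y) + c\<^sup>2 * (norm y)\<^sup>2"
  unfolding power2_norm_eq_inner
  by (simp add: inner_diff_left inner_diff_right inner_commute power2_eq_square algebra_simps)

lemma harmonic_on_image_kernel:
  assumes "c *\<^sub>R y \<notin> S"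
  shows "harmonic_on S (image_kernel y c)"
proof -
  have "image_kernel y c = (\<lambda>x. c * (1 / (norm (x - c *\<^sub>R y))\<^sup>2))"
    by (simp add: fun_eq_iff image_kernel_def)
  then show ?thesis using harmonic_on_cmult[OF harmonic_on_fundamental[OF assms]] by simp
qed

lemma continuous_on_image_kernel: "c *\<^sub>R y \<notin> S \<Longrightarrow> continuous_on S (image_kernel y c)"
  unfolding image_kernel_def[abs_def] by (intro continuous_intros) auto

text \<open>
  This is the Kelvin transform with respect to the sphere through \<open>x\<close> centred at the origin: the
  poles \<open>c y\<close> and \<open>|x|\<^sup>2 y / (|y|\<^sup>2 c)\<close> are inverse to each other in it.  On the unit sphere it
  exchanges \<open>c\<close> and \<open>1/(|y|\<^sup>2 c)\<close>, on the sphere of radius \<open>\<rho>\<close> it exchanges \<open>c\<close> and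
  \<open>\<rho>\<^sup>2/(|y|\<^sup>2 c)\<close>; all boundary computations below are instances of these two rules.
\<close>

lemma image_kernel_reflect:
  assumes "x \<noteq> 0" "y \<noteq> 0" "c \<noteq> 0"
  shows "image_kernel y ((norm x)\<^sup>2 / ((norm y)\<^sup>2 * c)) x = image_kernel y c x"
proof -
  define X Y d where "X = (norm x)\<^sup>2" and "Y = (norm y)\<^sup>2" and "d = x \<bullet> y"
  have nz: "X \<noteq> 0" "Y \<noteq> 0" using assms by (auto simp: X_def Y_def)
  define N where "N = X - 2 * c * d + c\<^sup>2 * Y"
  have "X - 2 * (X / (Y * c)) * d + (X / (Y * c))\<^sup>2 * Y = X / (Y * c\<^sup>2) * N"
    using nz assms(3) by (simp add: N_def field_simps power2_eq_square)
  moreover have "(X / (Y * c)) / (X / (Y * c\<^sup>2) * N) = c / N"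
    using nz assms(3) by (cases "N = 0") (simp_all add: field_simps power2_eq_square)
  ultimately show ?thesis
    unfolding image_kernel_def norm_diff_scaleR_sq by (fold X_def Y_def d_def) (simp add: N_def)
qed

text \<open>
  A charge at \<open>y\<close> is reflected repeatedly in the two spheres.  The images of even order lie at
  \<open>\<rho>\<^sup>2\<^sup>l y\<close>, those of odd order at \<open>\<rho>\<^sup>2\<^sup>l y / |y|\<^sup>2\<close>, with \<open>l\<close> an integer; leaving out the
  original charge \<open>l = 0\<close> of the first family and reversing the sign gives the regular part of
  the Green function, up to the factor \<open>2 \<omega>\<close>.  The truncation is chosen so that on either sphere
  the terms cancel in pairs, except for the potential of the charge itself and that of one
  remote image.
\<close>

definition image_sum :: "real \<Rightarrow> real^4 \<Rightarrow> nat \<Rightarrow> real^4 \<Rightarrow> real" where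
  "image_sum \<rho> y L x =
     (\<Sum>l<L. image_kernel y (1 / ((norm y)\<^sup>2 * (\<rho>\<^sup>2) ^ l)) x - image_kernel y (1 / (\<rho>\<^sup>2) ^ Suc l) x
          + image_kernel y ((\<rho>\<^sup>2) ^ Suc l / (norm y)\<^sup>2) x - image_kernel y ((\<rho>\<^sup>2) ^ Suc l) x)"

lemma image_sum_outer_boundary:
  assumes "norm x = 1" "y \<noteq> 0" "\<rho> > 0"
  shows "image_sum \<rho> y L x = image_kernel y 1 x - image_kernel y ((\<rho>\<^sup>2) ^ L) x"
proof (induction L)
  case (Suc L)
  define u where "u = \<rho>\<^sup>2"
  have u: "u ^ n \<noteq> 0" for n using assms by (simp add: u_def)
  have x: "x \<noteq> 0" using assms by auto
  have "image_kernel y (1 / ((norm y)\<^sup>2 * u ^ L)) x = image_kernel y (u ^ L) x"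
    using image_kernel_reflect[OF x assms(2) u[of L]] assms by simp
  moreover have "image_kernel y (u ^ Suc L / (norm y)\<^sup>2) x = image_kernel y (1 / u ^ Suc L) x"
    using image_kernel_reflect[OF x assms(2), of "1 / u ^ Suc L"] u[of "Suc L"] assms
    by (simp add: field_simps)
  ultimately show ?case
    using Suc unfolding image_sum_def by (fold u_def) simp
qed (simp add: image_sum_def)

lemma image_sum_inner_boundary:
  assumes "norm x = \<rho>" "y \<noteq> 0" "\<rho> > 0"
  shows "image_sum \<rho> y L x = image_kernel y 1 x - image_kernel y (1 / (\<rho>\<^sup>2) ^ L) x"
proof (induction L)
  case (Suc L)
  define u where "u = \<rho>\<^sup>2"
  have u: "u \<noteq> 0" "u ^ n \<noteq> 0" for n using assms by (simp_all add: u_def)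
  have x: "x \<noteq> 0" using assms by auto
  have nx: "(norm x)\<^sup>2 = u" using assms by (simp add: u_def)
  have "image_kernel y (1 / ((norm y)\<^sup>2 * u ^ L)) x = image_kernel y (u ^ Suc L) x"
    using image_kernel_reflect[OF x assms(2) u(2)[of "Suc L"]] u(1) by (simp add: nx)
  moreover have "image_kernel y (u ^ Suc L / (norm y)\<^sup>2) x = image_kernel y (1 / u ^ L) x"
    using image_kernel_reflect[OF x assms(2), of "1 / u ^ L"] u(2)[of L]
    by (simp add: nx field_simps)
  ultimately show ?case
    using Suc unfolding image_sum_def by (fold u_def) simp
qed (simp add: image_sum_def)

lemma image_kernel_le:
  assumes "c \<ge> 0" "0 < d" "d \<le> norm (x - c *\<^sub>R y)"
  shows "image_kernel y c x \<le> c / d\<^sup>2"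
  unfolding image_kernel_def using assms by (intro divide_left_mono power_mono mult_pos_pos zero_less_power) auto

lemma image_kernel_nonneg: "c \<ge> 0 \<Longrightarrow> image_kernel y c x \<ge> 0"
  by (simp add: image_kernel_def)

text \<open>
  The single uncancelled image is at \<open>\<rho>\<^sup>2\<^sup>L y\<close>, seen from the outer sphere, or at \<open>\<rho>\<^sup>-\<^sup>2\<^sup>L y\<close>, seen
  from the inner one.  Its distance from that sphere stays bounded away from zero after
  scaling, also when \<open>y\<close> approaches the boundary; this is why the bound is uniform in \<open>y\<close>.
\<close>

lemma image_sum_boundary_error:
  assumes \<rho>: "0 < \<rho>" "\<rho> < 1" and y: "y \<in> annulus \<rho>" and L: "L \<ge> 1"
    and x: "x \<in> frontier (annulus \<rho>)"
  shows "\<bar>image_kernel y 1 x - image_sum \<rho> y L x\<bar> \<le> (\<rho>\<^sup>2) ^ L / (\<rho> * (1 - \<rho>\<^sup>2))\<^sup>2"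
proof -
  define u where "u = \<rho>\<^sup>2"
  have u: "0 < u" "u < 1" using \<rho> by (auto simp: u_def power_less_one_iff)
  have uL: "0 < u ^ L" "u ^ L \<le> u"
    using u L power_decreasing[of 1 L u] by auto
  have y0: "y \<noteq> 0" and ny: "\<rho> < norm y" "norm y < 1" using y \<rho> by (auto simp: annulus_def)
  have "norm x = \<rho> \<or> norm x = 1" using x by (rule frontier_annulus_norm)
  then show ?thesis
  proof
    assume nx: "norm x = 1"
    have "u ^ L * norm y \<le> u * 1" using uL ny u by (intro mult_mono) auto
    then have "1 - u \<le> norm (x - u ^ L *\<^sub>R y)"
      using norm_triangle_ineq2[of x "u ^ L *\<^sub>R y"] nx uL by simp
    then have "image_kernel y (u ^ L) x \<le> u ^ L / (1 - u)\<^sup>2"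
      using u by (intro image_kernel_le) auto
    also have "\<dots> \<le> u ^ L / (\<rho> * (1 - u))\<^sup>2"
      using u \<rho> by (intro divide_left_mono power_mono mult_pos_pos) (auto simp: mult_le_cancel_right1)
    finally show ?thesis
      using image_sum_outer_boundary[OF nx y0 \<rho>(1), of L] image_kernel_nonneg[of "u ^ L" y x] uL
      by (simp add: u_def)
  next
    assume nx: "norm x = \<rho>"
    have "\<rho> * (1 - u) \<le> \<rho> * (1 - u ^ L)" using uL \<rho> by (intro mult_left_mono) auto
    also have "\<dots> \<le> norm y - \<rho> * u ^ L" using ny by (simp add: algebra_simps)
    finally have "\<rho> * (1 - u) / u ^ L \<le> (norm y - \<rho> * u ^ L) / u ^ L"
      using uL by (intro divide_right_mono) auto
    also have "\<dots> = norm y / u ^ L - \<rho>"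
      using uL by (simp add: diff_divide_distrib)
    also have "\<dots> \<le> norm (x - (1 / u ^ L) *\<^sub>R y)"
      using norm_triangle_ineq2[of "(1 / u ^ L) *\<^sub>R y" x] nx uL by (simp add: norm_minus_commute)
    finally have "image_kernel y (1 / u ^ L) x \<le> (1 / u ^ L) / (\<rho> * (1 - u) / u ^ L)\<^sup>2"
      using u \<rho> by (intro image_kernel_le) auto
    also have "\<dots> = u ^ L / (\<rho> * (1 - u))\<^sup>2"
      using uL by (simp add: power_divide) (simp add: power2_eq_square)
    finally show ?thesis
      using image_sum_inner_boundary[OF nx y0 \<rho>(1), of L] image_kernel_nonneg[of "1 / u ^ L" y x] uL
      by (simp add: u_def)
  qed
qed

lemma image_poles_outside:
  assumes \<rho>: "0 < \<rho>" "\<rho> < 1" and y: "y \<in> annulus \<rho>"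
  shows "(1 / ((norm y)\<^sup>2 * (\<rho>\<^sup>2) ^ l)) *\<^sub>R y \<notin> closure (annulus \<rho>)"
    and "(1 / (\<rho>\<^sup>2) ^ Suc l) *\<^sub>R y \<notin> closure (annulus \<rho>)"
    and "((\<rho>\<^sup>2) ^ Suc l / (norm y)\<^sup>2) *\<^sub>R y \<notin> closure (annulus \<rho>)"
    and "((\<rho>\<^sup>2) ^ Suc l) *\<^sub>R y \<notin> closure (annulus \<rho>)"
proof -
  define u where "u = \<rho>\<^sup>2"
  define r where "r = norm y"
  have "\<rho> * \<rho> < \<rho> * 1" using \<rho> by (intro mult_strict_left_mono) auto
  then have u: "0 < u" "u < \<rho>" using \<rho> by (simp_all add: u_def power2_eq_square)
  then have "u < 1" using \<rho> by linarith
  note u = u this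
  have r: "\<rho> < r" "r < 1" "0 < r" using y \<rho> by (auto simp: annulus_def r_def)
  have ul: "0 < u ^ l" "u ^ l \<le> 1" "0 < u ^ Suc l" "u ^ Suc l \<le> u"
    using u power_le_one[of u l] by (auto simp: mult_left_le)
  have out: "z \<notin> closure (annulus \<rho>)" if "norm z < \<rho> \<or> 1 < norm z" for z
    using closure_annulus_norm[of z \<rho>] that by linarith
  have "r * u ^ l \<le> r * 1" using r ul by (intro mult_left_mono) auto
  then have "r * u ^ l < 1" using r by linarith
  then have "1 < norm ((1 / (r\<^sup>2 * u ^ l)) *\<^sub>R y)"
    using r ul by (simp add: r_def[symmetric] power2_eq_square field_simps)
  then show "(1 / ((norm y)\<^sup>2 * (\<rho>\<^sup>2) ^ l)) *\<^sub>R y \<notin> closure (annulus \<rho>)"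
    by (intro out) (simp add: r_def u_def)
  have "u ^ Suc l < r" using ul u r by linarith
  then have "1 < norm ((1 / u ^ Suc l) *\<^sub>R y)"
    using ul by (simp add: r_def[symmetric] field_simps)
  then show "(1 / (\<rho>\<^sup>2) ^ Suc l) *\<^sub>R y \<notin> closure (annulus \<rho>)"
    by (intro out) (simp add: u_def)
  have "u ^ Suc l \<le> \<rho> * \<rho>" using ul by (simp add: u_def power2_eq_square)
  also have "\<dots> < \<rho> * r" using r \<rho> by simp
  finally have "norm ((u ^ Suc l / r\<^sup>2) *\<^sub>R y) < \<rho>"
    using r ul by (simp add: r_def[symmetric] power2_eq_square field_simps)
  then show "((\<rho>\<^sup>2) ^ Suc l / (norm y)\<^sup>2) *\<^sub>R y \<notin> closure (annulus \<rho>)"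
    by (intro out) (simp add: r_def u_def)
  have "u ^ Suc l * r \<le> u * 1" using ul r u by (intro mult_mono) auto
  moreover have "norm (u ^ Suc l *\<^sub>R y) = u ^ Suc l * r" using ul by (simp add: r_def)
  ultimately have "norm (u ^ Suc l *\<^sub>R y) < \<rho>" using u by linarith
  then show "((\<rho>\<^sup>2) ^ Suc l) *\<^sub>R y \<notin> closure (annulus \<rho>)"
    by (intro out) (simp add: u_def)
qed

text \<open>
  Working with finite sums and the maximum principle avoids differentiating an infinite
  series of images.
\<close>

lemma image_sum_approximates_regular_part:
  assumes \<rho>: "0 < \<rho>" "\<rho> < 1" and H: "green_regular_part \<rho> H"
    and y: "y \<in> annulus \<rho>" and x: "x \<in> annulus \<rho>" and L: "L \<ge> 1"
  shows "\<bar>2 * omega * H x y - image_sum \<rho> y L x\<bar> \<le> (\<rho>\<^sup>2) ^ L / (\<rho> * (1 - \<rho>\<^sup>2))\<^sup>2"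
proof -
  let ?A = "annulus \<rho>"
  define w where "w = (\<lambda>x. 2 * omega * H x y - image_sum \<rho> y L x)"
  define e where "e = (\<rho>\<^sup>2) ^ L / (\<rho> * (1 - \<rho>\<^sup>2))\<^sup>2"
  have sub: "?A \<subseteq> closure ?A" by (rule closure_subset)
  note poles = image_poles_outside[OF \<rho> y]
  have "harmonic_on ?A (image_sum \<rho> y L)"
    unfolding image_sum_def[abs_def]
    using poles sub
    by (intro harmonic_on_sum harmonic_on_add harmonic_on_diff harmonic_on_image_kernel) blast+
  then have harm: "harmonic_on ?A w"
    unfolding w_def using H y
    by (intro harmonic_on_diff harmonic_on_cmult) (auto simp: green_regular_part_def)
  have cont: "continuous_on (closure ?A) w"
    unfolding w_def image_sum_def using H y poles
    by (intro continuous_on_diff continuous_on_mult continuous_on_const continuous_on_sum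
        continuous_on_add continuous_on_image_kernel) (auto simp: green_regular_part_def)
  have bd: "\<bar>w z\<bar> \<le> e" if z: "z \<in> frontier ?A" for z
  proof -
    have "omega > 0" by (simp add: omega_def)
    moreover have "H z y = fund_sol z y" using H y z by (auto simp: green_regular_part_def)
    ultimately have "2 * omega * H z y = image_kernel y 1 z"
      by (simp add: fund_sol_def image_kernel_def)
    then show ?thesis
      using image_sum_boundary_error[OF \<rho> y L z] by (simp add: w_def e_def)
  qed
  have "w x \<le> e"
    by (rule harmonic_le_on_frontier_imp_le[OF annulus_open annulus_bounded cont harm _ x])
       (use bd in \<open>force simp: abs_le_iff\<close>)
  moreover have "- 1 * w x \<le> e"
    by (rule harmonic_le_on_frontier_imp_le[OF annulus_open annulus_bounded
          continuous_on_mult_left[OF cont] harmonic_on_cmult[OF harm] _ x])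
       (use bd in \<open>force simp: abs_le_iff\<close>)
  ultimately show ?thesis by (simp add: w_def e_def abs_le_iff)
qed

section \<open>The energy of a regular polygon\<close>

text \<open>
  For \<open>x\<close> and \<open>y\<close> on a common circle of radius \<open>r\<close> with angle \<open>\<theta>\<close> between them, this is
  \<open>r\<^sup>2\<close> times the potential at \<open>x\<close> of the image at \<open>t y\<close>, where \<open>a = cos \<theta>\<close>.
\<close>

definition circle_kernel :: "real \<Rightarrow> real \<Rightarrow> real" where
  "circle_kernel a t = t / (1 - 2 * a * t + t\<^sup>2)"

lemma circle_kernel_denom_pos:
  fixes a t :: real
  assumes "\<bar>a\<bar> \<le> 1" "0 < t" "t < 1"
  shows "1 - 2 * a * t + t\<^sup>2 > 0"
proof -
  have "(1 - t)\<^sup>2 > 0" using assms by simp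
  moreover have "a * t \<le> 1 * t" using assms by (intro mult_right_mono) auto
  ultimately show ?thesis by (simp add: power2_eq_square algebra_simps)
qed

text \<open>
  For two points on the same circle the images at \<open>t y\<close> and at \<open>y/t\<close> contribute equally.  This
  brings all parameters into the interval \<open>(0,1)\<close>.
\<close>

lemma circle_kernel_inverse: "circle_kernel a (1 / t) = circle_kernel a t"
proof (cases "t = 0")
  case False
  have "1 - 2 * a * (1 / t) + (1 / t)\<^sup>2 = (1 - 2 * a * t + t\<^sup>2) / t\<^sup>2"
    using False by (simp add: field_simps power2_eq_square)
  then show ?thesis using False by (simp add: circle_kernel_def power2_eq_square)
qed (simp add: circle_kernel_def)

lemma image_kernel_on_circle:
  assumes "norm x = r" "norm y = r" "x \<bullet> y = r\<^sup>2 * a" "r \<noteq> 0"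
  shows "r\<^sup>2 * image_kernel y c x = circle_kernel a c"
proof -
  have "(norm (x - c *\<^sub>R y))\<^sup>2 = r\<^sup>2 * (1 - 2 * a * c + c\<^sup>2)"
    unfolding norm_diff_scaleR_sq assms by (simp add: algebra_simps)
  then show ?thesis using assms(4) by (simp add: image_kernel_def circle_kernel_def)
qed

lemma image_sum_on_circle:
  assumes "norm x = r" "norm y = r" "x \<bullet> y = r\<^sup>2 * a" "r \<noteq> 0"
  shows "r\<^sup>2 * image_sum \<rho> y L x =
    (\<Sum>l<L. circle_kernel a (r\<^sup>2 * (\<rho>\<^sup>2) ^ l) + circle_kernel a ((\<rho>\<^sup>2) ^ Suc l / r\<^sup>2)
       - 2 * circle_kernel a ((\<rho>\<^sup>2) ^ Suc l))"
  unfolding image_sum_def sum_distrib_left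
  by (intro sum.cong refl)
     (simp only: distrib_left right_diff_distrib image_kernel_on_circle[OF assms] circle_kernel_inverse assms(2))

lemma inner_xi:
  "xi k 1 r \<bullet> xi k (j + 1) r = r\<^sup>2 * cos (2 * pi * real j / real k)"
  by (simp add: xi_def inner_vec_def sum_4 power2_eq_square)

lemma norm_xi: "0 \<le> r \<Longrightarrow> norm (xi k j r) = r"
proof -
  assume r: "0 \<le> r"
  have "(norm (xi k j r))\<^sup>2 = r\<^sup>2 * ((cos (2 * pi * (real j - 1) / real k))\<^sup>2 + (sin (2 * pi * (real j - 1) / real k))\<^sup>2)"
    unfolding power2_norm_eq_inner distrib_left by (simp add: xi_def inner_vec_def sum_4 power2_eq_square mult_ac)
  then show "norm (xi k j r) = r" using r by simp
qed

definition orbit_kernel :: "nat \<Rightarrow> real \<Rightarrow> real" where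
  "orbit_kernel k t = (\<Sum>j<k. circle_kernel (cos (2 * pi * real j / real k)) t)"

definition pair_energy :: "nat \<Rightarrow> real" where
  "pair_energy k = (\<Sum>j=1..k-1. 1 / (2 - 2 * cos (2 * pi * real j / real k)))"

text \<open>
  The \<open>l\<close>-th quadruple of images, summed over all vertices.  The arguments \<open>r\<^sup>2 \<rho>\<^sup>2\<^sup>l\<close> and
  \<open>\<rho>\<^sup>2\<^sup>l\<^sup>+\<^sup>2/r\<^sup>2\<close> come from the odd reflections; the two even ones coincide after inversion, hence
  the factor \<open>2\<close>.
\<close>

definition energy_layer :: "nat \<Rightarrow> real \<Rightarrow> nat \<Rightarrow> real \<Rightarrow> real" where
  "energy_layer k \<rho> l r = orbit_kernel k (r\<^sup>2 * (\<rho>\<^sup>2) ^ l) + orbit_kernel k ((\<rho>\<^sup>2) ^ Suc l / r\<^sup>2)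
     - 2 * orbit_kernel k ((\<rho>\<^sup>2) ^ Suc l)"

text \<open>
  The self-interaction of the first vertex and the regular parts of the interactions with
  the others combine into one sum over all vertices; the singular parts contribute the constant
  \<open>pair_energy k\<close>.
\<close>

lemma Lambda1_approx:
  assumes \<rho>: "0 < \<rho>" "\<rho> < 1" and H: "green_regular_part \<rho> H"
    and r: "\<rho> < r" "r < 1" and L: "L \<ge> 1" and k: "k \<ge> 1"
  shows "\<bar>2 * omega * r\<^sup>2 * Lambda1 H k r - ((\<Sum>l<L. energy_layer k \<rho> l r) - pair_energy k)\<bar>
           \<le> real k * ((\<rho>\<^sup>2) ^ L / (\<rho> * (1 - \<rho>\<^sup>2))\<^sup>2)"
proof -
  define e where "e = (\<rho>\<^sup>2) ^ L / (\<rho> * (1 - \<rho>\<^sup>2))\<^sup>2"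
  define x where "x = xi k 1 r"
  define y where "y = (\<lambda>j. xi k (j + 1) r)"
  define a where "a = (\<lambda>j. cos (2 * pi * real j / real k))"
  have r0: "0 < r" using r \<rho> by simp
  have nx: "norm x = r" and ny: "norm (y j) = r" for j
    using norm_xi r0 by (simp_all add: x_def y_def)
  have ip: "x \<bullet> y j = r\<^sup>2 * a j" for j
    using inner_xi by (simp add: x_def y_def a_def)
  have ann: "x \<in> annulus \<rho>" "y j \<in> annulus \<rho>" for j
    using nx ny r by (auto simp: annulus_def)
  have om: "omega > 0" by (simp add: omega_def)
  have split: "{..<k} = insert 0 {1..k-1}" using k by auto
  have fs: "2 * omega * r\<^sup>2 * fund_sol x (y j) = 1 / (2 - 2 * a j)" for j
    using image_kernel_on_circle[OF nx ny ip, of j 1] om r0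
    by (simp add: fund_sol_def image_kernel_def circle_kernel_def field_simps)
  have y0: "y 0 = x" by (simp add: y_def x_def)
  have lam: "2 * omega * r\<^sup>2 * Lambda1 H k r = (\<Sum>j<k. r\<^sup>2 * (2 * omega * H x (y j))) - pair_energy k"
  proof -
    have "Lambda1 H k r = H x (y 0) - (\<Sum>j=1..k-1. fund_sol x (y j) - H x (y j))"
      unfolding Lambda1_def robin_def green_def y0 by (simp add: x_def y_def)
    also have "\<dots> = (\<Sum>j<k. H x (y j)) - (\<Sum>j=1..k-1. fund_sol x (y j))"
      unfolding split by (subst sum.insert) (auto simp: sum_subtractf)
    finally have "2 * omega * r\<^sup>2 * Lambda1 H k r
       = (\<Sum>j<k. 2 * omega * r\<^sup>2 * H x (y j)) - (\<Sum>j=1..k-1. 2 * omega * r\<^sup>2 * fund_sol x (y j))"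
      by (simp add: right_diff_distrib sum_distrib_left)
    then show ?thesis unfolding fs by (simp add: pair_energy_def a_def mult_ac)
  qed
  have en: "(\<Sum>l<L. energy_layer k \<rho> l r) = (\<Sum>j<k. r\<^sup>2 * image_sum \<rho> (y j) L x)"
  proof -
    have "(\<Sum>j<k. r\<^sup>2 * image_sum \<rho> (y j) L x) = (\<Sum>l<L. \<Sum>j<k. circle_kernel (a j) (r\<^sup>2 * (\<rho>\<^sup>2) ^ l)
        + circle_kernel (a j) ((\<rho>\<^sup>2) ^ Suc l / r\<^sup>2) - 2 * circle_kernel (a j) ((\<rho>\<^sup>2) ^ Suc l))"
      using r0 by (subst sum.swap) (intro sum.cong refl image_sum_on_circle[OF nx ny ip], simp)
    also have "\<dots> = (\<Sum>l<L. energy_layer k \<rho> l r)"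
      unfolding energy_layer_def orbit_kernel_def a_def
      by (simp only: sum.distrib sum_subtractf sum_distrib_left)
    finally show ?thesis by simp
  qed
  have "\<bar>r\<^sup>2 * (2 * omega * H x (y j)) - r\<^sup>2 * image_sum \<rho> (y j) L x\<bar> \<le> e" for j
  proof -
    have d: "\<bar>2 * omega * H x (y j) - image_sum \<rho> (y j) L x\<bar> \<le> e"
      unfolding e_def by (rule image_sum_approximates_regular_part[OF \<rho> H ann(2,1) L])
    have "r\<^sup>2 * \<bar>2 * omega * H x (y j) - image_sum \<rho> (y j) L x\<bar> \<le> 1 * e"
      using r r0 d by (intro mult_mono) (auto simp: power_le_one)
    then show ?thesis by (simp add: abs_mult flip: right_diff_distrib)
  qed
  then have "(\<Sum>j<k. \<bar>r\<^sup>2 * (2 * omega * H x (y j)) - r\<^sup>2 * image_sum \<rho> (y j) L x\<bar>) \<le> real k * e"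
    using sum_bounded_above[of "{..<k}" _ e] by simp
  then have "\<bar>\<Sum>j<k. r\<^sup>2 * (2 * omega * H x (y j)) - r\<^sup>2 * image_sum \<rho> (y j) L x\<bar> \<le> real k * e"
    by (rule order_trans[OF sum_abs])
  then show ?thesis unfolding lam en e_def by (simp add: sum_subtractf)
qed

lemma continuous_on_energy_layer:
  assumes "0 < \<rho>" "\<rho> < 1"
  shows "continuous_on {\<rho><..<1} (energy_layer k \<rho> l)"
proof -
  have c: "continuous_on {\<rho><..<1} (\<lambda>r. orbit_kernel k (f r))"
    if "continuous_on {\<rho><..<1} f" "\<And>r. r \<in> {\<rho><..<1} \<Longrightarrow> 0 < f r \<and> f r < 1" for f :: "real \<Rightarrow> real"
    unfolding orbit_kernel_def circle_kernel_def
    using that(2) by (intro continuous_intros that(1) ballI)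
      (metis circle_kernel_denom_pos abs_cos_le_one less_irrefl)
  define u where "u = \<rho>\<^sup>2"
  have u: "0 < u" "u < 1" using assms by (auto simp: u_def power_less_one_iff)
  have 1: "0 < r\<^sup>2 * u ^ l \<and> r\<^sup>2 * u ^ l < 1" if "r \<in> {\<rho><..<1}" for r
  proof -
    have "r\<^sup>2 < 1" "0 < r" using that assms by (auto simp: power_less_one_iff)
    moreover have "r\<^sup>2 * u ^ l \<le> r\<^sup>2 * 1" using u by (intro mult_left_mono) (auto simp: power_le_one)
    ultimately have "r\<^sup>2 * u ^ l < 1" by linarith
    then show ?thesis using u \<open>0 < r\<close> by simp
  qed
  have 2: "0 < u ^ Suc l / r\<^sup>2 \<and> u ^ Suc l / r\<^sup>2 < 1" if "r \<in> {\<rho><..<1}" for r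
  proof -
    have "u ^ Suc l \<le> u" using u by (simp add: mult_left_le power_le_one)
    moreover have "u < r\<^sup>2" unfolding u_def using that assms by (intro power_strict_mono) auto
    ultimately have "u ^ Suc l < r\<^sup>2" by linarith
    moreover have "0 < u ^ Suc l" "0 < r\<^sup>2" using u that assms by simp_all
    ultimately show ?thesis by (simp only: divide_pos_pos divide_less_eq_1_pos simp_thms)
  qed
  show ?thesis
    unfolding energy_layer_def using assms
    by (fold u_def) (intro continuous_on_diff continuous_on_add continuous_on_const c 1 2 continuous_intros; auto)
qed

text \<open>
  Because \<open>\<rho> < r < 1\<close>, both \<open>r\<^sup>2 \<rho>\<^sup>2\<^sup>l\<close> and \<open>\<rho>\<^sup>2\<^sup>l\<^sup>+\<^sup>2/r\<^sup>2\<close> exceed \<open>\<rho>\<^sup>2\<^sup>l\<^sup>+\<^sup>2\<close>, so monotonicity alone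
  makes the two positive terms win.
\<close>

lemma energy_layer_nonneg:
  assumes "0 < \<rho>" "\<rho> < r" "r < 1" and mono: "mono_on {0<..<1} (orbit_kernel k)"
  shows "energy_layer k \<rho> l r \<ge> 0"
proof -
  define u where "u = \<rho>\<^sup>2"
  have u: "0 < u" "u < r\<^sup>2" "r\<^sup>2 < 1" "r > 0"
    unfolding u_def using assms by (auto simp: power_less_one_iff intro: power_strict_mono)
  then have ul: "0 < u ^ l" "u ^ l \<le> 1" by (auto simp: power_le_one)
  have S: "u ^ Suc l < r\<^sup>2 * u ^ l" "u ^ Suc l < u ^ Suc l / r\<^sup>2"
  proof -
    show "u ^ Suc l < r\<^sup>2 * u ^ l" using u ul by simp
    show "u ^ Suc l < u ^ Suc l / r\<^sup>2"
      using u mult_strict_left_mono[of "r\<^sup>2" 1 "u ^ Suc l"] by (simp add: pos_less_divide_eq)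
  qed
  have A: "r\<^sup>2 * u ^ l < 1" using mult_left_mono[OF ul(2), of "r\<^sup>2"] u by linarith
  have "u ^ Suc l < r\<^sup>2"
    using mult_left_mono[OF ul(2), of u] u by (simp only: power_Suc) linarith
  then have B: "u ^ Suc l / r\<^sup>2 < 1" using u by simp
  have S0: "0 < u ^ Suc l" using u by simp
  have "orbit_kernel k (u ^ Suc l) \<le> orbit_kernel k (r\<^sup>2 * u ^ l)"
    by (rule mono_onD[OF mono]) (use S A B S0 in auto)
  moreover have "orbit_kernel k (u ^ Suc l) \<le> orbit_kernel k (u ^ Suc l / r\<^sup>2)"
    by (rule mono_onD[OF mono]) (use S A B S0 in auto)
  ultimately show ?thesis unfolding energy_layer_def by (fold u_def) simp
qed

lemma orbit_kernel_ge:
  assumes "0 < t" "t < 1" "k \<ge> 1"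
  shows "t / (1 - t)\<^sup>2 \<le> orbit_kernel k t"
proof -
  have "circle_kernel (cos (2 * pi * real 0 / real k)) t \<le> orbit_kernel k t"
    unfolding orbit_kernel_def using assms
    by (intro member_le_sum) (auto simp: circle_kernel_def intro!: divide_nonneg_pos circle_kernel_denom_pos)
  then show ?thesis by (simp add: circle_kernel_def power2_diff power2_eq_square algebra_simps)
qed

lemma attains_min_on_open_interval:
  fixes f :: "real \<Rightarrow> real"
  assumes ab: "a < b" and cont: "continuous_on {a<..<b} f"
    and lim: "filterlim f at_top (at_right a)" "filterlim f at_top (at_left b)"
  shows "\<exists>x\<in>{a<..<b}. \<forall>y\<in>{a<..<b}. f x \<le> f y"
proof -
  define m where "m = (a + b) / 2"
  have m: "a < m" "m < b" using ab by (auto simp: m_def)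
  have "\<forall>\<^sub>F x in at_right a. f m \<le> f x" using lim(1) by (simp add: filterlim_at_top)
  then obtain c where c: "c > a" "\<And>x. a < x \<Longrightarrow> x < c \<Longrightarrow> f m \<le> f x"
    unfolding eventually_at_right_field by blast
  have "\<forall>\<^sub>F x in at_left b. f m \<le> f x" using lim(2) by (simp add: filterlim_at_top)
  then obtain d where d: "d < b" "\<And>x. d < x \<Longrightarrow> x < b \<Longrightarrow> f m \<le> f x"
    unfolding eventually_at_left_field by blast
  define I where "I = {min c m..max d m}"
  have I: "I \<subseteq> {a<..<b}" "m \<in> I" using m c d by (auto simp: I_def)
  obtain x where x: "x \<in> I" "\<And>y. y \<in> I \<Longrightarrow> f x \<le> f y"
    using continuous_attains_inf[of I f] continuous_on_subset[OF cont I(1)] I(2)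
    unfolding I_def by blast
  have "f x \<le> f y" if y: "y \<in> {a<..<b}" for y
  proof (cases "y \<in> I")
    case False
    then have "f m \<le> f y" using y c d by (auto simp: I_def)
    with x(2)[OF I(2)] show ?thesis by simp
  qed (use x in auto)
  with x I show ?thesis by blast
qed

text \<open>
  Both facts come from \<open>Lambda1_approx\<close>: the error tends to zero uniformly in \<open>r\<close>, which gives
  continuity, and every layer after the first only increases the sum.
\<close>

lemma
  assumes \<rho>: "0 < \<rho>" "\<rho> < 1" and H: "green_regular_part \<rho> H" and k: "k \<ge> 1"
  shows continuous_on_Lambda1: "continuous_on {\<rho><..<1} (Lambda1 H k)"
    and Lambda1_ge_first_layer: "mono_on {0<..<1} (orbit_kernel k) \<Longrightarrow> \<rho> < r \<Longrightarrow> r < 1 \<Longrightarrow>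
      energy_layer k \<rho> 0 r - pair_energy k \<le> 2 * omega * r\<^sup>2 * Lambda1 H k r"
proof -
  let ?I = "{\<rho><..<1}"
  define F where "F = (\<lambda>r. 2 * omega * r\<^sup>2 * Lambda1 H k r)"
  define E where "E = (\<lambda>L r. (\<Sum>l<L. energy_layer k \<rho> l r) - pair_energy k)"
  define D where "D = (\<rho> * (1 - \<rho>\<^sup>2))\<^sup>2"
  have om: "omega > 0" by (simp add: omega_def)
  have "\<bar>\<rho>\<^sup>2\<bar> < 1" using \<rho> by (simp add: power_less_one_iff)
  then have "(\<lambda>L. real k * ((\<rho>\<^sup>2) ^ L / D)) \<longlonglongrightarrow> 0"
    by (auto intro!: tendsto_eq_intros LIMSEQ_abs_realpow_zero2 tendsto_divide_zero tendsto_mult_right_zero)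
  have unif: "uniform_limit ?I E F sequentially"
  proof (rule uniform_limitI)
    fix e :: real assume "e > 0"
    with \<open>_ \<longlonglongrightarrow> 0\<close> have "\<forall>\<^sub>F L in sequentially. real k * ((\<rho>\<^sup>2) ^ L / D) < e"
      by (rule order_tendstoD)
    with eventually_ge_at_top[of 1] show "\<forall>\<^sub>F L in sequentially. \<forall>r\<in>?I. dist (E L r) (F r) < e"
    proof eventually_elim
      case (elim L)
      have "\<bar>F r - E L r\<bar> \<le> real k * ((\<rho>\<^sup>2) ^ L / D)" if "r \<in> ?I" for r
        unfolding F_def E_def D_def by (rule Lambda1_approx[OF \<rho> H _ _ elim(1) k]) (use that in auto)
      with elim(2) show ?case by (force simp: dist_real_def abs_minus_commute)
    qed
  qed
  have "continuous_on ?I F"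
    by (rule uniform_limit_theorem[OF _ unif])
       (auto simp: E_def intro!: always_eventually continuous_on_diff continuous_on_sum
          continuous_on_energy_layer[OF \<rho>] continuous_on_const)
  then have "continuous_on ?I (\<lambda>r. F r / (2 * omega * r\<^sup>2))"
    using \<rho> om by (intro continuous_intros) auto
  then show "continuous_on ?I (Lambda1 H k)"
    by (rule continuous_on_eq) (use \<rho> om in \<open>auto simp: F_def\<close>)
  assume mono: "mono_on {0<..<1} (orbit_kernel k)" and r: "\<rho> < r" "r < 1"
  have "E 1 r \<le> E L r" if "L \<ge> 1" for L
  proof -
    have "(\<Sum>l<1. energy_layer k \<rho> l r) \<le> (\<Sum>l<L. energy_layer k \<rho> l r)"
      using that by (intro sum_mono2) (auto intro: energy_layer_nonneg[OF \<rho>(1) r mono])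
    then show ?thesis by (simp add: E_def)
  qed
  moreover have "(\<lambda>L. E L r) \<longlonglongrightarrow> F r"
    by (rule tendsto_uniform_limitI[OF unif]) (use r in auto)
  ultimately have "E 1 r \<le> F r" by (intro LIMSEQ_le_const[of "\<lambda>L. E L r"]) auto
  then show "energy_layer k \<rho> 0 r - pair_energy k \<le> 2 * omega * r\<^sup>2 * Lambda1 H k r"
    by (simp add: E_def F_def)
qed

lemma filterlim_div_one_minus_sq_at_top:
  fixes f :: "'a \<Rightarrow> real"
  assumes "(f \<longlongrightarrow> 1) F" "\<forall>\<^sub>F x in F. f x < 1"
  shows "filterlim (\<lambda>x. f x / (1 - f x)\<^sup>2) at_top F"
proof (rule LIM_at_top_divide[OF assms(1)])
  have "((\<lambda>x. (1 - f x)\<^sup>2) \<longlongrightarrow> (1 - 1)\<^sup>2) F" by (intro tendsto_intros assms)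
  then show "((\<lambda>x. (1 - f x)\<^sup>2) \<longlongrightarrow> 0) F" by simp
  show "\<forall>\<^sub>F x in F. 0 < (1 - f x)\<^sup>2" using assms(2) by eventually_elim simp
qed simp

text \<open>
  The hypothesis on the first layer makes \<open>Lambda1 H k\<close> positive.  Up to a constant the first
  layer dominates \<open>s/(1 - s)\<^sup>2\<close> for both \<open>s = r\<^sup>2\<close> and \<open>s = \<rho>\<^sup>2/r\<^sup>2\<close>, the contribution of a vertex
  and its own image; the former parameter tends to \<open>1\<close> as \<open>r \<rightarrow> 1\<close>, the latter as
  \<open>r \<rightarrow> \<rho>\<close>.  So \<open>Lambda1 H k\<close> blows up at both ends and attains its minimum in between.
\<close>

lemma Lambda1_has_positive_min:
  assumes \<rho>: "0 < \<rho>" "\<rho> < 1" and H: "green_regular_part \<rho> H" and k: "k \<ge> 1"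
    and mono: "mono_on {0<..<1} (orbit_kernel k)"
    and pos: "\<And>r. \<rho> < r \<Longrightarrow> r < 1 \<Longrightarrow> pair_energy k < energy_layer k \<rho> 0 r"
  shows "has_positive_min_on {\<rho><..<1} (Lambda1 H k)"
proof -
  have om: "omega > 0" by (simp add: omega_def)
  define c where "c = 2 * orbit_kernel k (\<rho>\<^sup>2) + pair_energy k"
  have Lpos: "0 < Lambda1 H k r" if "\<rho> < r" "r < 1" for r
  proof -
    have "0 < 2 * omega * r\<^sup>2 * Lambda1 H k r"
      using Lambda1_ge_first_layer[OF \<rho> H k mono that] pos[OF that] by linarith
    moreover have "0 < 2 * omega * r\<^sup>2" using om that \<rho> by simp
    ultimately show ?thesis by (rule zero_less_mult_pos)
  qed
  have lower: "(s / (1 - s)\<^sup>2 - c) / (2 * omega) \<le> Lambda1 H k r"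
    if r: "\<rho> < r" "r < 1" and s: "s = r\<^sup>2 \<or> s = \<rho>\<^sup>2 / r\<^sup>2" for r s
  proof -
    have sq: "\<rho>\<^sup>2 < r\<^sup>2" "r\<^sup>2 < 1" "0 < \<rho>\<^sup>2"
      using r \<rho> by (auto simp: power_less_one_iff intro: power_strict_mono)
    have t01: "0 < t \<and> t < 1" if "t = r\<^sup>2 \<or> t = \<rho>\<^sup>2 / r\<^sup>2" for t
      using that sq r \<rho> by auto
    have ge: "t / (1 - t)\<^sup>2 \<le> orbit_kernel k t" and nn: "0 \<le> t / (1 - t)\<^sup>2"
      if "t = r\<^sup>2 \<or> t = \<rho>\<^sup>2 / r\<^sup>2" for t
      using t01[OF that] orbit_kernel_ge[of t k] k by auto
    have "s / (1 - s)\<^sup>2 \<le> orbit_kernel k (r\<^sup>2) + orbit_kernel k (\<rho>\<^sup>2 / r\<^sup>2)"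
      using s
    proof
      assume e: "s = r\<^sup>2"
      show ?thesis unfolding e using ge[OF disjI1[OF refl]] ge[OF disjI2[OF refl]] nn[OF disjI2[OF refl]] by linarith
    next
      assume e: "s = \<rho>\<^sup>2 / r\<^sup>2"
      show ?thesis unfolding e using ge[OF disjI1[OF refl]] ge[OF disjI2[OF refl]] nn[OF disjI1[OF refl]] by linarith
    qed
    then have "s / (1 - s)\<^sup>2 - c \<le> 2 * omega * r\<^sup>2 * Lambda1 H k r"
      using Lambda1_ge_first_layer[OF \<rho> H k mono r] by (simp add: energy_layer_def c_def)
    also have "\<dots> \<le> 2 * omega * 1 * Lambda1 H k r"
      using sq om Lpos[OF r] by (intro mult_right_mono mult_left_mono) auto
    finally show ?thesis using om by (simp add: field_simps)
  qed
  have top: "filterlim (Lambda1 H k) at_top F"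
    if F: "\<forall>\<^sub>F r in F. \<rho> < r \<and> r < 1" and s: "\<And>r. s r = r\<^sup>2 \<or> s r = \<rho>\<^sup>2 / r\<^sup>2"
      and lim: "(s \<longlongrightarrow> 1) F" for F s
  proof -
    have "\<forall>\<^sub>F r in F. s r < 1"
      using F
    proof eventually_elim
      case (elim r)
      then have "\<rho>\<^sup>2 < r\<^sup>2" "r\<^sup>2 < 1" using \<rho> by (auto simp: power_less_one_iff intro: power_strict_mono)
      then show ?case using s[of r] elim \<rho> by auto
    qed
    then have "filterlim (\<lambda>r. s r / (1 - s r)\<^sup>2) at_top F" by (rule filterlim_div_one_minus_sq_at_top[OF lim])
    then have "filterlim (\<lambda>r. - c + s r / (1 - s r)\<^sup>2) at_top F"
      by (rule filterlim_tendsto_add_at_top[OF tendsto_const])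
    then have "filterlim (\<lambda>r. 1 / (2 * omega) * (- c + s r / (1 - s r)\<^sup>2)) at_top F"
      using om by (intro filterlim_tendsto_pos_mult_at_top[OF tendsto_const]) auto
    then show ?thesis
    proof (rule filterlim_at_top_mono)
      show "\<forall>\<^sub>F r in F. 1 / (2 * omega) * (- c + s r / (1 - s r)\<^sup>2) \<le> Lambda1 H k r"
        using F
      proof eventually_elim
        case (elim r)
        then show ?case using lower[of r "s r"] s[of r] by simp
      qed
    qed
  qed
  have "filterlim (Lambda1 H k) at_top (at_left 1)"
  proof (rule top[of _ "\<lambda>r. r\<^sup>2"])
    show "\<forall>\<^sub>F r in at_left 1. \<rho> < r \<and> r < 1"
      unfolding eventually_at_left_field using \<rho> by (intro exI[of _ \<rho>]) auto
    show "((\<lambda>r. r\<^sup>2) \<longlongrightarrow> 1) (at_left (1 :: real))" by (auto intro!: tendsto_eq_intros)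
  qed simp
  moreover have "filterlim (Lambda1 H k) at_top (at_right \<rho>)"
  proof (rule top[of _ "\<lambda>r. \<rho>\<^sup>2 / r\<^sup>2"])
    show "\<forall>\<^sub>F r in at_right \<rho>. \<rho> < r \<and> r < 1"
      unfolding eventually_at_right_field using \<rho> by (intro exI[of _ 1]) auto
    show "((\<lambda>r. \<rho>\<^sup>2 / r\<^sup>2) \<longlongrightarrow> 1) (at_right \<rho>)" using \<rho> by (auto intro!: tendsto_eq_intros)
  qed simp
  ultimately obtain r0 where "r0 \<in> {\<rho><..<1}" "\<forall>r\<in>{\<rho><..<1}. Lambda1 H k r0 \<le> Lambda1 H k r"
    using attains_min_on_open_interval[OF \<rho>(2) continuous_on_Lambda1[OF \<rho> H k]] by blast
  then show ?thesis using Lpos[of r0] unfolding has_positive_min_on_def by auto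
qed

text \<open>
  Of the two numbers \<open>r\<^sup>2\<close> and \<open>\<rho>\<^sup>2/r\<^sup>2\<close>, whose product is \<open>\<rho>\<^sup>2\<close>, one is at least \<open>\<rho>\<close> and both are at
  least \<open>\<rho>\<^sup>2\<close>.
\<close>

lemma first_layer_ge:
  assumes "0 < \<rho>" "\<rho> < r" "r < 1" and mono: "mono_on {0<..<1} (orbit_kernel k)"
  shows "orbit_kernel k \<rho> - orbit_kernel k (\<rho>\<^sup>2) \<le> energy_layer k \<rho> 0 r"
proof -
  define A B where "A = r\<^sup>2" and "B = \<rho>\<^sup>2 / r\<^sup>2"
  have sq: "\<rho>\<^sup>2 < r\<^sup>2" "r\<^sup>2 < 1" "0 < \<rho>\<^sup>2"
    using assms by (auto simp: power_less_one_iff intro: power_strict_mono)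
  have AB: "A < 1" "B < 1" "\<rho>\<^sup>2 \<le> A" "\<rho>\<^sup>2 \<le> B" "A * B = \<rho> * \<rho>"
    using sq assms by (auto simp: A_def B_def field_simps power2_eq_square)
  have AB0: "0 \<le> A" "0 \<le> B" using AB sq by linarith+
  have le: "orbit_kernel k s \<le> orbit_kernel k t" if "0 < s" "s \<le> t" "t < 1" for s t
    by (rule mono_onD[OF mono]) (use that in auto)
  have "\<rho> \<le> A \<or> \<rho> \<le> B"
  proof (rule ccontr)
    assume "\<not> ?thesis"
    then have "A * B < \<rho> * \<rho>" using AB AB0 assms(1) by (intro mult_strict_mono) auto
    with AB show False by simp
  qed
  then have "orbit_kernel k \<rho> + orbit_kernel k (\<rho>\<^sup>2) \<le> orbit_kernel k A + orbit_kernel k B"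
    using le[of \<rho> A] le[of \<rho> B] le[of "\<rho>\<^sup>2" A] le[of "\<rho>\<^sup>2" B] AB assms sq by auto
  then show ?thesis by (simp add: energy_layer_def A_def B_def)
qed

section \<open>The cases of two and four vertices\<close>

lemma orbit_kernel_2:
  assumes "0 < t" "t < 1"
  shows "orbit_kernel 2 t = 2 * t * (1 + t\<^sup>2) / (1 - t\<^sup>2)\<^sup>2"
proof -
  have "orbit_kernel 2 t = t / (1 - t)\<^sup>2 + t / (1 + t)\<^sup>2"
    by (simp add: orbit_kernel_def circle_kernel_def numeral_2_eq_2 power2_eq_square algebra_simps)
  also have "\<dots> = (t * (1 + t)\<^sup>2 + t * (1 - t)\<^sup>2) / ((1 - t)\<^sup>2 * (1 + t)\<^sup>2)"
    using assms by (subst add_frac_eq) (auto simp: algebra_simps)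
  also have "(1 - t)\<^sup>2 * (1 + t)\<^sup>2 = (1 - t\<^sup>2)\<^sup>2" by (simp add: power2_eq_square algebra_simps)
  also have "t * (1 + t)\<^sup>2 + t * (1 - t)\<^sup>2 = 2 * t * (1 + t\<^sup>2)" by (simp add: power2_eq_square algebra_simps)
  finally show ?thesis .
qed

lemma orbit_kernel_4:
  assumes "0 < t" "t < 1"
  shows "orbit_kernel 4 t = 4 * t * (1 + t ^ 4) / ((1 - t\<^sup>2) * (1 - t ^ 4))"
proof -
  have c3: "cos (pi * 3 / 2) = 0" using cos_3over2_pi by (simp add: mult_ac)
  have "{..<4} = {0, 1, 2, 3 :: nat}" by auto
  then have "orbit_kernel 4 t = orbit_kernel 2 t + 2 * t / (1 + t\<^sup>2)"
    using c3 by (simp add: orbit_kernel_def circle_kernel_def numeral_2_eq_2 mult_ac)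
  also have "\<dots> = 2 * t * (1 + t\<^sup>2) / (1 - t\<^sup>2)\<^sup>2 + 2 * t / (1 + t\<^sup>2)"
    by (simp add: orbit_kernel_2[OF assms])
  also have "\<dots> = (2 * t * (1 + t\<^sup>2) * (1 + t\<^sup>2) + 2 * t * (1 - t\<^sup>2)\<^sup>2) / ((1 - t\<^sup>2)\<^sup>2 * (1 + t\<^sup>2))"
    using assms power_less_one_iff[of t 2] by (subst add_frac_eq) (auto simp: algebra_simps add_nonneg_eq_0_iff)
  also have "2 * t * (1 + t\<^sup>2) * (1 + t\<^sup>2) + 2 * t * (1 - t\<^sup>2)\<^sup>2 = 4 * t * (1 + t ^ 4)"
    by (simp add: power2_eq_square power4_eq_xxxx algebra_simps)
  also have "(1 - t\<^sup>2)\<^sup>2 * (1 + t\<^sup>2) = (1 - t\<^sup>2) * (1 - t ^ 4)"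
    by (simp add: power2_eq_square power4_eq_xxxx algebra_simps)
  finally show ?thesis .
qed

lemma mono_orbit_kernel_2: "mono_on {0<..<1} (orbit_kernel 2)"
proof (rule mono_onI)
  fix s t :: real assume st: "s \<in> {0<..<1}" "t \<in> {0<..<1}" "s \<le> t"
  have "s\<^sup>2 \<le> t\<^sup>2" "t\<^sup>2 < 1" using st by (auto simp: power_mono power_less_one_iff)
  then have "2 * s * (1 + s\<^sup>2) / (1 - s\<^sup>2)\<^sup>2 \<le> 2 * t * (1 + t\<^sup>2) / (1 - t\<^sup>2)\<^sup>2"
    using st by (intro frac_le mult_mono power_mono) auto
  then show "orbit_kernel 2 s \<le> orbit_kernel 2 t" using st by (simp add: orbit_kernel_2)
qed

lemma mono_orbit_kernel_4: "mono_on {0<..<1} (orbit_kernel 4)"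
proof (rule mono_onI)
  fix s t :: real assume st: "s \<in> {0<..<1}" "t \<in> {0<..<1}" "s \<le> t"
  have "s\<^sup>2 \<le> t\<^sup>2" "t\<^sup>2 < 1" "s\<^sup>2 \<le> 1" "s ^ 4 \<le> t ^ 4" "t ^ 4 < 1" "s ^ 4 \<le> 1"
    using st by (auto simp: power_less_one_iff intro: power_mono power_le_one)
  then have "4 * s * (1 + s ^ 4) / ((1 - s\<^sup>2) * (1 - s ^ 4)) \<le> 4 * t * (1 + t ^ 4) / ((1 - t\<^sup>2) * (1 - t ^ 4))"
    using st by (intro frac_le mult_mono mult_pos_pos) (auto intro: power_le_one)
  then show "orbit_kernel 4 s \<le> orbit_kernel 4 t" using st by (simp add: orbit_kernel_4)
qed

lemma pair_energy_2: "pair_energy 2 = 1 / 4"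
  by (simp add: pair_energy_def)

lemma pair_energy_4: "pair_energy 4 = 5 / 4"
proof -
  have c3: "cos (pi * 3 / 2) = 0" using cos_3over2_pi by (simp add: mult_ac)
  have "{1..4 - 1} = {1, 2, 3 :: nat}" by auto
  then show ?thesis using c3 by (simp add: pair_energy_def mult_ac)
qed

text \<open>
  Over the common denominator \<open>(1 - p\<^sup>4)(1 - p\<^sup>8)\<close>, which is at most \<open>1\<close>, the numerator is at
  least \<open>4 p (1 - p + p\<^sup>2)\<close>.  This increases with \<open>p\<close> and already exceeds \<open>5/4\<close> at \<open>5/11\<close>.
\<close>

lemma orbit_kernel_4_gap:
  assumes p: "5/11 < p" "p < 1"
  shows "orbit_kernel 4 p - orbit_kernel 4 (p\<^sup>2) > 5 / 4"
proof -
  have lt: "p\<^sup>2 < 1" "p ^ 4 < 1" "p ^ 8 < 1" using p by (auto simp: power_less_one_iff)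
  have k: "orbit_kernel 4 (p\<^sup>2) = 4 * p\<^sup>2 * (1 + p ^ 8) / ((1 - p ^ 4) * (1 - p ^ 8))"
    using orbit_kernel_4[of "p\<^sup>2"] p lt by (simp flip: power_mult)
  have "orbit_kernel 4 p = 4 * p * (1 + p ^ 4) * ((1 + p\<^sup>2) * (1 + p ^ 4)) / (((1 - p\<^sup>2) * (1 - p ^ 4)) * ((1 + p\<^sup>2) * (1 + p ^ 4)))"
    using p lt by (subst orbit_kernel_4) (auto simp: add_nonneg_eq_0_iff)
  also have "((1 - p\<^sup>2) * (1 - p ^ 4)) * ((1 + p\<^sup>2) * (1 + p ^ 4)) = (1 - p ^ 4) * (1 - p ^ 8)"
    by (simp add: algebra_simps flip: power_add)
  finally have eq: "orbit_kernel 4 p - orbit_kernel 4 (p\<^sup>2)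
      = (4 * p * (1 + p ^ 4) * ((1 + p\<^sup>2) * (1 + p ^ 4)) - 4 * p\<^sup>2 * (1 + p ^ 8)) / ((1 - p ^ 4) * (1 - p ^ 8))"
    unfolding k by (simp add: diff_divide_distrib)
  have "5 / 4 * ((1 - p ^ 4) * (1 - p ^ 8)) \<le> 5 / 4 * (1 * 1)"
    using lt p by (intro mult_left_mono mult_mono) auto
  also have "\<dots> < 4 * (5 / 11 * (1 - 5 / 11 + (5 / 11)\<^sup>2))" by (simp add: power2_eq_square)
  also have "\<dots> < 4 * (p * (1 - p + p\<^sup>2))"
  proof -
    \<comment> \<open>The cofactor of \<open>p - a\<close> in \<open>p (1 - p + p\<^sup>2) - a (1 - a + a\<^sup>2)\<close>, at \<open>a = 5/11\<close>.\<close>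
    have "0 < (p - 5 / 11) * ((1 - p) + (p\<^sup>2 + (5 / 11) * p + (5 / 11)\<^sup>2 - 5 / 11))"
    proof (rule mult_pos_pos)
      have "(5 / 11)\<^sup>2 \<le> p\<^sup>2" using p by (intro power_mono) auto
      then show "0 < (1 - p) + (p\<^sup>2 + (5 / 11) * p + (5 / 11)\<^sup>2 - 5 / 11)"
        using p by (simp add: power2_eq_square)
    qed (use p in simp)
    moreover have "p * (1 - p + p\<^sup>2) - a * (1 - a + a\<^sup>2) = (p - a) * ((1 - p) + (p\<^sup>2 + a * p + a\<^sup>2 - a))" for a
      by (simp add: power2_eq_square algebra_simps)
    ultimately have "0 < p * (1 - p + p\<^sup>2) - 5 / 11 * (1 - 5 / 11 + (5 / 11)\<^sup>2)" by metis
    then show ?thesis by linarith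
  qed
  also have "\<dots> \<le> 4 * p * (1 + p ^ 4) * ((1 + p\<^sup>2) * (1 + p ^ 4)) - 4 * p\<^sup>2 * (1 + p ^ 8)"
  proof -
    have "p ^ 10 \<le> p ^ 5" using p by (intro power_decreasing) auto
    moreover have "0 \<le> p ^ 7" "0 \<le> p ^ 9" "0 \<le> p ^ 11" "0 \<le> p ^ 5" using p by auto
    moreover have "4 * p * (1 + p ^ 4) * ((1 + p\<^sup>2) * (1 + p ^ 4)) - 4 * p\<^sup>2 * (1 + p ^ 8) - 4 * (p * (1 - p + p\<^sup>2))
      = 8 * p ^ 5 + 8 * p ^ 7 + 4 * p ^ 9 + 4 * p ^ 11 - 4 * p ^ 10"
      by (simp add: algebra_simps eval_nat_numeral)
    ultimately show ?thesis by linarith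
  qed
  finally show ?thesis unfolding eq using lt by (subst pos_less_divide_eq) auto
qed

text \<open>
  Over the common denominator \<open>(1 - p\<^sup>4)\<^sup>2\<close>, which is at most \<open>1\<close>, the numerator has leading
  part \<open>p (2 - 2 p + 6 p\<^sup>2)\<close>.  The second factor has minimum \<open>11/6\<close>, attained at \<open>p = 1/6\<close>, so
  \<open>p \<ge> 3/20\<close> leaves a margin over \<open>1/4\<close>.
\<close>

lemma orbit_kernel_2_gap:
  assumes p: "3/20 \<le> p" "p < 1"
  shows "orbit_kernel 2 p - orbit_kernel 2 (p\<^sup>2) > 1 / 4"
proof -
  have lt: "p\<^sup>2 < 1" "p ^ 4 < 1" using p by (auto simp: power_less_one_iff)
  have k: "orbit_kernel 2 (p\<^sup>2) = 2 * p\<^sup>2 * (1 + p ^ 4) / (1 - p ^ 4)\<^sup>2"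
    using orbit_kernel_2[of "p\<^sup>2"] p lt by (simp flip: power_mult)
  have "orbit_kernel 2 p = 2 * p * (1 + p\<^sup>2) * (1 + p\<^sup>2)\<^sup>2 / ((1 - p\<^sup>2)\<^sup>2 * (1 + p\<^sup>2)\<^sup>2)"
    using p lt by (subst orbit_kernel_2) (auto simp: add_nonneg_eq_0_iff)
  also have "(1 - p\<^sup>2)\<^sup>2 * (1 + p\<^sup>2)\<^sup>2 = (1 - p ^ 4)\<^sup>2"
    by (simp add: algebra_simps power2_eq_square power4_eq_xxxx)
  finally have eq: "orbit_kernel 2 p - orbit_kernel 2 (p\<^sup>2)
      = (2 * p * (1 + p\<^sup>2) * (1 + p\<^sup>2)\<^sup>2 - 2 * p\<^sup>2 * (1 + p ^ 4)) / (1 - p ^ 4)\<^sup>2"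
    unfolding k by (simp add: diff_divide_distrib)
  have "1 / 4 * (1 - p ^ 4)\<^sup>2 \<le> 1 / 4 * 1"
    using lt p by (intro mult_left_mono power_le_one) auto
  also have "\<dots> < 3 / 20 * (11 / 6)" by simp
  also have "\<dots> \<le> p * (2 - 2 * p + 6 * p\<^sup>2)"
  proof (rule mult_mono)
    have "0 \<le> 6 * (p - 1 / 6)\<^sup>2" by simp
    then show "11 / 6 \<le> 2 - 2 * p + 6 * p\<^sup>2" by (simp add: power2_eq_square algebra_simps)
  qed (use p in auto)
  also have "\<dots> \<le> 2 * p * (1 + p\<^sup>2) * (1 + p\<^sup>2)\<^sup>2 - 2 * p\<^sup>2 * (1 + p ^ 4)"
  proof -
    have "p ^ 6 \<le> p ^ 5" using p by (intro power_decreasing) auto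
    moreover have "0 \<le> p ^ 7" "0 \<le> p ^ 5" using p by auto
    moreover have "2 * p * (1 + p\<^sup>2) * (1 + p\<^sup>2)\<^sup>2 - 2 * p\<^sup>2 * (1 + p ^ 4) - p * (2 - 2 * p + 6 * p\<^sup>2)
      = 6 * p ^ 5 + 2 * p ^ 7 - 2 * p ^ 6"
      by (simp add: algebra_simps eval_nat_numeral)
    ultimately show ?thesis by linarith
  qed
  finally show ?thesis unfolding eq using lt by (subst pos_less_divide_eq) auto
qed

text \<open>
  The power series is \<open>2 t + 6 t\<^sup>3 + 10 t\<^sup>5 + \<dots>\<close>; the lower bound is its truncation, and the
  cubic coefficient \<open>8\<close> absorbs the tail for small \<open>t\<close>.
\<close>

lemma orbit_kernel_2_bounds:
  assumes "0 < t" "t < 1"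
  shows "2 * t + 6 * t ^ 3 \<le> orbit_kernel 2 t"
    and "t \<le> 1 / 3 \<Longrightarrow> orbit_kernel 2 t \<le> 2 * t + 8 * t ^ 3"
proof -
  define z where "z = t\<^sup>2"
  have z: "0 < z" "z < 1" using assms by (auto simp: z_def power_less_one_iff)
  have k: "orbit_kernel 2 t = 2 * t * ((1 + z) / (1 - z)\<^sup>2)"
    by (simp add: orbit_kernel_2[OF assms] z_def)
  have t3: "t ^ 3 = t * z" by (simp add: z_def power3_eq_cube power2_eq_square)
  have "(1 + 3 * z) * (1 - z)\<^sup>2 = 1 + z - z * z * (5 - 3 * z)"
    by (simp add: power2_eq_square algebra_simps)
  also have "\<dots> \<le> 1 + z" using z by simp
  finally have "1 + 3 * z \<le> (1 + z) / (1 - z)\<^sup>2" using z by (simp add: pos_le_divide_eq)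
  then have "2 * t * (1 + 3 * z) \<le> orbit_kernel 2 t"
    unfolding k using assms by (intro mult_left_mono) auto
  then show "2 * t + 6 * t ^ 3 \<le> orbit_kernel 2 t" unfolding t3 by (simp add: algebra_simps)
  assume "t \<le> 1 / 3"
  then have z9: "z \<le> 1 / 9" using assms power_mono[of t "1/3" 2] by (simp add: z_def power2_eq_square)
  have "0 \<le> z * (1 - 7 * z + 4 * z\<^sup>2)" using z z9 by (intro mult_nonneg_nonneg add_nonneg_nonneg) auto
  then have "1 + z \<le> (1 + 4 * z) * (1 - z)\<^sup>2"
    by (simp add: power2_eq_square algebra_simps)
  then have "(1 + z) / (1 - z)\<^sup>2 \<le> 1 + 4 * z" using z by (simp add: pos_divide_le_eq)
  then have "orbit_kernel 2 t \<le> 2 * t * (1 + 4 * z)"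
    unfolding k using assms by (intro mult_left_mono) auto
  then show "orbit_kernel 2 t \<le> 2 * t + 8 * t ^ 3" unfolding t3 by (simp add: algebra_simps)
qed

text \<open>
  At \<open>r\<^sup>2 = \<rho>\<close>, where both \<open>r\<^sup>2\<close> and \<open>\<rho>\<^sup>2/r\<^sup>2\<close> equal \<open>\<rho>\<close>, the bound \<open>first_layer_ge\<close> loses a
  factor \<open>2\<close>, too much for small \<open>\<rho>\<close>.  The arithmetic-geometric mean inequality, applied to the
  linear and the cubic terms, recovers it.  At \<open>\<rho> = 1/15\<close> the linear and quadratic terms \<open>4 \<rho> - 4 \<rho>\<^sup>2\<close> alone give a little less than \<open>1/4\<close>, so the cubic term is
  indispensable there.
\<close>

lemma first_layer_2_gt:
  assumes \<rho>: "1/15 < \<rho>" "\<rho> < 3/20" and r: "\<rho> < r" "r < 1"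
  shows "energy_layer 2 \<rho> 0 r > 1 / 4"
proof -
  define A B where "A = r\<^sup>2" and "B = \<rho>\<^sup>2 / r\<^sup>2"
  have sq: "\<rho>\<^sup>2 < r\<^sup>2" "r\<^sup>2 < 1" "0 < \<rho>\<^sup>2"
    using assms by (auto simp: power_less_one_iff intro: power_strict_mono)
  have AB: "0 < A" "0 < B" "A < 1" "B < 1" "A * B = \<rho>\<^sup>2"
    using sq assms by (auto simp: A_def B_def)
  define s where "s = A + B"
  have "s\<^sup>2 = (A - B)\<^sup>2 + 4 * (A * B)"
    by (simp add: s_def power2_eq_square algebra_simps)
  then have s2: "4 * \<rho>\<^sup>2 \<le> s\<^sup>2" unfolding AB(5) by simp
  then have "(2 * \<rho>)\<^sup>2 \<le> s\<^sup>2" by (simp add: power_mult_distrib)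
  then have s: "2 * \<rho> \<le> s" by (rule power2_le_imp_le) (use AB in \<open>simp add: s_def\<close>)
  have "2 * \<rho> * \<rho>\<^sup>2 \<le> s * (s\<^sup>2 - 3 * \<rho>\<^sup>2)"
    using s s2 \<rho> by (intro mult_mono) auto
  also have "\<dots> = A ^ 3 + B ^ 3"
    unfolding AB(5)[symmetric] s_def by (simp add: power2_eq_square power3_eq_cube algebra_simps)
  finally have cubes: "2 * \<rho> ^ 3 \<le> A ^ 3 + B ^ 3" by (simp add: power2_eq_square power3_eq_cube)
  have q: "0 < \<rho>\<^sup>2" "\<rho>\<^sup>2 < 1" "\<rho>\<^sup>2 \<le> 1 / 3"
    using sq \<rho> power_mono[of \<rho> "3/20" 2] by (auto simp: power2_eq_square)
  have "1 / 4 < 4 * \<rho> + 12 * \<rho> ^ 3 - 4 * \<rho>\<^sup>2 - 16 * (\<rho>\<^sup>2) ^ 3"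
  proof -
    have "\<rho> ^ 3 * (16 * \<rho> ^ 3) \<le> \<rho> ^ 3 * 1"
      using \<rho> power_mono[of \<rho> "3/20" 3] by (intro mult_left_mono) (auto simp: power3_eq_cube)
    then have "16 * (\<rho>\<^sup>2) ^ 3 \<le> \<rho> ^ 3" by (simp add: power2_eq_square power3_eq_cube mult_ac)
    \<comment> \<open>What remains to be bounded, \<open>4 \<rho> - 4 \<rho>\<^sup>2 + 11 \<rho>\<^sup>3\<close>, is made quadratic here and
       linear, by the chord of \<open>\<rho>\<^sup>2\<close> over \<open>[1/15, 3/20]\<close>, in the next step.\<close>
    moreover have "1 / 15 * \<rho>\<^sup>2 \<le> \<rho> ^ 3"
      using \<rho> by (simp add: power2_eq_square power3_eq_cube)
    moreover have "\<rho>\<^sup>2 \<le> 13 / 60 * \<rho> - 1 / 100"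
    proof -
      have "0 < (\<rho> - 1 / 15) * (3 / 20 - \<rho>)" using \<rho> by (intro mult_pos_pos) auto
      moreover have "(\<rho> - 1 / 15) * (3 / 20 - \<rho>) = 13 / 60 * \<rho> - 1 / 100 - \<rho>\<^sup>2"
        by (simp add: power2_eq_square field_simps)
      ultimately show ?thesis by linarith
    qed
    ultimately show ?thesis using \<rho> by linarith
  qed
  also have "\<dots> \<le> orbit_kernel 2 A + orbit_kernel 2 B - 2 * orbit_kernel 2 (\<rho>\<^sup>2)"
    using orbit_kernel_2_bounds(1)[OF AB(1,3)] orbit_kernel_2_bounds(1)[OF AB(2,4)]
      orbit_kernel_2_bounds(2)[OF q] s cubes unfolding s_def by linarith
  also have "\<dots> = energy_layer 2 \<rho> 0 r" by (simp add: energy_layer_def A_def B_def)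
  finally show ?thesis .
qed

theorem proposition4p2:
  fixes \<rho> :: real and H :: "real^4 \<Rightarrow> real^4 \<Rightarrow> real"
  assumes "0 < \<rho>" and "\<rho> < 1"
    and "green_regular_part \<rho> H"
  shows "(1/15 < \<rho> \<longrightarrow> has_positive_min_on {\<rho><..<1} (Lambda1 H 2)) \<and>
         (5/11 < \<rho> \<longrightarrow> has_positive_min_on {\<rho><..<1} (Lambda1 H 4))"
proof (intro conjI impI)
  assume p: "1/15 < \<rho>"
  show "has_positive_min_on {\<rho><..<1} (Lambda1 H 2)"
  proof (rule Lambda1_has_positive_min[OF assms _ mono_orbit_kernel_2])
    fix r assume r: "\<rho> < r" "r < 1"
    show "pair_energy 2 < energy_layer 2 \<rho> 0 r"
    proof (cases "\<rho> < 3/20")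
      case True
      then show ?thesis using first_layer_2_gt[OF p True r] by (simp add: pair_energy_2)
    next
      case False
      then show ?thesis
        using orbit_kernel_2_gap[of \<rho>] first_layer_ge[OF assms(1) r mono_orbit_kernel_2] assms
        by (simp add: pair_energy_2)
    qed
  qed simp
next
  assume p: "5/11 < \<rho>"
  show "has_positive_min_on {\<rho><..<1} (Lambda1 H 4)"
  proof (rule Lambda1_has_positive_min[OF assms _ mono_orbit_kernel_4])
    fix r assume r: "\<rho> < r" "r < 1"
    show "pair_energy 4 < energy_layer 4 \<rho> 0 r"
      using orbit_kernel_4_gap[OF p assms(2)] first_layer_ge[OF assms(1) r mono_orbit_kernel_4]
      by (simp add: pair_energy_4)
  qed simp
qed

end
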